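(* Let $d\ge 1$ and let $\mathbf{s}=(s_1,\ldots,s_d)$ be a sequence of positive integers such that $s_i\le s_{i+1}$ and $0\le s_{i+1}-s_i\le 1$ for all $1\le i\le d-1$. Then $\mathbf{P}_d^{(\mathbf{s})}$ is translation equivalent to a Fano polytope if and only if $s_d=d+1$. Moreover, in this case the unique interior lattice point of $\mathbf{P}_d^{(\mathbf{s})}$ is $(x_d,x_{d-1},\ldots,x_1)^T=(d,d-1,\ldots,2,1)^T$.
   Context: For a sequence of positive integers $\mathbf{s}=(s_1,\ldots,s_d)$, the $\mathbf{s}$-lecture hall polytope is $\mathbf{P}_d^{(\mathbf{s})}=\{\mathbf{x}\in\mathbb{R}^d : 0\le \frac{x_1}{s_1}\le\frac{x_2}{s_2}\le\cdots\le\frac{x_d}{s_d}\le 1\}$, a $d$-dimensional lattice polytope. Points are written as column vectors with $x_d$ as first entry and $x_1$ as last entry. A $d$-dimensional lattice polytope $\mathcal{P}\subset\mathbb{R}^d$ is Fano if $(\mathcal{P}\setminus\partial\mathcal{P})\cap\mathbb{Z}^d=\{\mathbf{0}\}$. Two lattice polytopes are translation equivalent if one is the translate of the other by a vector in $\mathbb{Z}^d$. *)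

theory Defs
  imports "HOL-Analysis.Analysis"
begin

text \<open>
  A point \<open>x\<close> of \<open>\<real>\<^sup>d\<close> is a vector of type \<open>real ^ 'n\<close> over a linearly ordered index type with
  \<open>CARD('n) = d\<close>. Coordinates are numbered from 1 to \<open>d\<close>: \<open>coord x k\<close> is the coordinate \<open>x\<^sub>k\<close>,
  stored at the \<open>k\<close>-th smallest index. Nothing is claimed about \<open>coord x k\<close> for other \<open>k\<close>.
\<close>

definition index :: "nat \<Rightarrow> 'n::{finite,linorder}" where
  "index k = sorted_list_of_set UNIV ! (k - 1)"

definition coord :: "'a ^ 'n::{finite,linorder} \<Rightarrow> nat \<Rightarrow> 'a" where
  "coord x k = x $ index k"

lemma bij_betw_index:
  "bij_betw (index :: nat \<Rightarrow> 'n::{finite,linorder}) {1..CARD('n)} UNIV"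
proof -
  let ?xs = "sorted_list_of_set (UNIV :: 'n set)"
  have "bij_betw (\<lambda>k. k - 1) {1..CARD('n)} {..<CARD('n)}"
    by (rule bij_betw_byWitness[where f' = Suc]) auto
  moreover have "bij_betw ((!) ?xs) {..<CARD('n)} UNIV"
    by (rule bij_betw_nth) auto
  ultimately have "bij_betw ((!) ?xs \<circ> (\<lambda>k. k - 1)) {1..CARD('n)} UNIV"
    by (rule bij_betw_trans)
  then show ?thesis
    by (simp add: index_def[abs_def] comp_def)
qed

definition lecture_hall_polytope :: "(nat \<Rightarrow> nat) \<Rightarrow> (real ^ 'n::{finite,linorder}) set" where
  "lecture_hall_polytope s =
    {x. 0 \<le> coord x 1 / real (s 1) \<and>
        (\<forall>k\<in>{1..<CARD('n)}. coord x k / real (s k) \<le> coord x (k + 1) / real (s (k + 1))) \<and>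
        coord x CARD('n) / real (s CARD('n)) \<le> 1}"

definition integer_lattice :: "(real ^ 'n) set" where
  "integer_lattice = {x. \<forall>i. x $ i \<in> \<int>}"

definition lattice_polytope :: "(real ^ 'n) set \<Rightarrow> bool" where
  "lattice_polytope P \<longleftrightarrow> (\<exists>V. finite V \<and> V \<subseteq> integer_lattice \<and> P = convex hull V)"

definition interior_lattice_points :: "(real ^ 'n) set \<Rightarrow> (real ^ 'n) set" where
  "interior_lattice_points P = (P - frontier P) \<inter> integer_lattice"

definition fano_polytope :: "(real ^ 'n) set \<Rightarrow> bool" where
  "fano_polytope P \<longleftrightarrow>
    lattice_polytope P \<and> aff_dim P = int CARD('n) \<and> interior_lattice_points P = {0}"

definition translation_equivalent :: "(real ^ 'n) set \<Rightarrow> (real ^ 'n) set \<Rightarrow> bool" where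
  "translation_equivalent P Q \<longleftrightarrow> (\<exists>a\<in>integer_lattice. Q = (\<lambda>x. a + x) ` P)"

end

theory Submission
  imports Defs
begin

text \<open>
  Extending the ratios \<open>x\<^sub>k / s\<^sub>k\<close> by \<open>0\<close> at \<open>k = 0\<close> and by \<open>1\<close> at \<open>k = d + 1\<close> turns the polytope
  into the set of points with weakly increasing heights, and its interior into those with strictly
  increasing heights; the increments of the heights are barycentric coordinates with respect to the
  vertices \<open>(0, \<dots>, 0, s\<^sub>j\<^sub>+\<^sub>1, \<dots>, s\<^sub>d)\<close>. As \<open>s\<close> is increasing, the coordinates of an interior lattice
  point strictly increase from at least \<open>1\<close> to at most \<open>s\<^sub>d - 1\<close>, so that \<open>s\<^sub>d \<ge> d + 1\<close>, with
  \<open>(1, \<dots>, d)\<close> as the only candidate if \<open>s\<^sub>d = d + 1\<close>. Conversely, as \<open>s\<close> has steps of at most \<open>1\<close>,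
  the point \<open>(1 + c, \<dots>, d + c)\<close> is interior whenever \<open>d + c < s\<^sub>d\<close>, which gives two interior lattice
  points if \<open>s\<^sub>d \<ge> d + 2\<close>.
\<close>

section \<open>Coordinates and the integer lattice\<close>

definition vector_of :: "(nat \<Rightarrow> 'a) \<Rightarrow> 'a ^ 'n::{finite,linorder}" where
  "vector_of g = (\<chi> i. g (inv_into {1..CARD('n)} index i))"

lemma coord_vector_of:
  assumes "k \<in> {1..CARD('n::{finite,linorder})}"
  shows "coord (vector_of g :: 'a ^ 'n::{finite,linorder}) k = g k"
  using assms bij_betw_index[where 'n = 'n]
  by (simp add: coord_def vector_of_def inv_into_f_f bij_betw_imp_inj_on)

lemma index_exhaust:
  obtains k where "k \<in> {1..CARD('n::{finite,linorder})}" "i = (index k :: 'n)"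
  using bij_betw_index[where 'n = 'n] by (metis UNIV_I bij_betw_def imageE)

lemma vec_eq_coordI:
  fixes x y :: "'a ^ 'n::{finite,linorder}"
  assumes "\<And>k. k \<in> {1..CARD('n)} \<Longrightarrow> coord x k = coord y k"
  shows "x = y"
  using assms unfolding vec_eq_iff coord_def by (metis index_exhaust)

lemma coord_sum: "coord (sum f A) k = (\<Sum>j\<in>A. coord (f j) k)"
  by (simp add: coord_def)

lemma coord_scaleR: "coord (c *\<^sub>R x) k = c * coord x k" for x :: "real ^ 'n::{finite,linorder}"
  by (simp add: coord_def)

lemma integer_lattice_iff_coord:
  fixes x :: "real ^ 'n::{finite,linorder}"
  shows "x \<in> integer_lattice \<longleftrightarrow> (\<forall>k\<in>{1..CARD('n)}. coord x k \<in> \<int>)"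
  unfolding integer_lattice_def coord_def mem_Collect_eq by (metis index_exhaust)

lemma integer_lattice_add:
  "x \<in> integer_lattice \<Longrightarrow> y \<in> integer_lattice \<Longrightarrow> x + y \<in> integer_lattice"
  by (simp add: integer_lattice_def)

lemma integer_lattice_uminus: "x \<in> integer_lattice \<Longrightarrow> - x \<in> integer_lattice"
  by (simp add: integer_lattice_def)

section \<open>Lattice translations and the Fano property\<close>

lemma interior_lattice_points_altdef: "interior_lattice_points P = interior P \<inter> integer_lattice"
  using closure_subset[of P] interior_subset[of P]
  by (auto simp: interior_lattice_points_def frontier_def)

lemma interior_lattice_points_translation:
  assumes "a \<in> integer_lattice"
  shows "interior_lattice_points ((+) a ` P) = (+) a ` interior_lattice_points P"
proof -
  have "a + x \<in> integer_lattice \<longleftrightarrow> x \<in> integer_lattice" for x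
    using integer_lattice_add[OF assms, of x]
      integer_lattice_add[OF integer_lattice_uminus[OF assms], of "a + x"] by auto
  then show ?thesis
    by (auto simp: interior_lattice_points_altdef interior_translation)
qed

lemma lattice_polytope_translation:
  assumes "a \<in> integer_lattice" "lattice_polytope P"
  shows "lattice_polytope ((+) a ` P)"
proof -
  obtain V where "finite V" "V \<subseteq> integer_lattice" "P = convex hull V"
    using assms(2) by (auto simp: lattice_polytope_def)
  moreover have "(+) a ` (convex hull V) = convex hull ((+) a ` V)"
    by (simp add: convex_hull_translation)
  moreover have "(+) a ` V \<subseteq> integer_lattice"
    using assms(1) \<open>V \<subseteq> integer_lattice\<close> by (auto intro: integer_lattice_add)
  ultimately show ?thesis
    unfolding lattice_polytope_def by blast
qed

text \<open>Translating by \<open>- p\<close> moves the unique interior lattice point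
  \<open>p\<close> to the origin, and no other lattice translation can do so. This reduces the Fano
  condition to counting interior lattice points.\<close>

lemma translate_fano_iff:
  fixes P :: "(real ^ 'n) set"
  assumes "lattice_polytope P"
  shows "(\<exists>Q. fano_polytope Q \<and> translation_equivalent P Q) \<longleftrightarrow>
    (\<exists>p. interior_lattice_points P = {p})"
proof
  assume "\<exists>Q. fano_polytope Q \<and> translation_equivalent P Q"
  then obtain a where a: "a \<in> integer_lattice" "fano_polytope ((+) a ` P)"
    by (auto simp: translation_equivalent_def)
  \<comment> \<open>Writing \<open>0\<close> as \<open>a + (- a)\<close> lets injectivity of the
    translation cancel \<open>a\<close>.\<close>
  then have "(+) a ` interior_lattice_points P = (+) a ` {- a}"
    by (simp add: fano_polytope_def interior_lattice_points_translation)
  then have "interior_lattice_points P = {- a}"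
    by (simp only: inj_image_eq_iff[OF inj_on_add])
  then show "\<exists>p. interior_lattice_points P = {p}" ..
next
  assume "\<exists>p. interior_lattice_points P = {p}"
  then obtain p where p: "interior_lattice_points P = {p}" ..
  then have p': "- p \<in> integer_lattice" "p \<in> interior P"
    by (auto simp: interior_lattice_points_altdef intro: integer_lattice_uminus)
  \<comment> \<open>Full dimension comes for free: \<open>p\<close> witnesses that the interior is
    nonempty.\<close>
  then have "aff_dim P = int CARD('n)"
    using aff_dim_nonempty_interior[of P] by auto
  then have "fano_polytope ((+) (- p) ` P)"
    unfolding fano_polytope_def
    using lattice_polytope_translation[OF p'(1) assms]
      interior_lattice_points_translation[OF p'(1), of P] p aff_dim_translation_eq[of "- p" P]
    by simp
  then show "\<exists>Q. fano_polytope Q \<and> translation_equivalent P Q"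
    using p'(1) unfolding translation_equivalent_def by blast
qed

section \<open>Heights, half-spaces and the interior\<close>

definition height :: "(nat \<Rightarrow> nat) \<Rightarrow> real ^ 'n::{finite,linorder} \<Rightarrow> nat \<Rightarrow> real" where
  "height s x k =
    (if k = 0 then 0 else if CARD('n) < k then 1 else coord x k / real (s k))"

lemma height_0 [simp]: "height s x 0 = 0"
  by (simp add: height_def)

lemma height_Suc_card [simp]: "height s (x :: real ^ 'n::{finite,linorder}) (Suc CARD('n)) = 1"
  by (simp add: height_def)

lemma height_eq:
  fixes x :: "real ^ 'n::{finite,linorder}"
  shows "k \<in> {1..CARD('n)} \<Longrightarrow> height s x k = coord x k / real (s k)"
  by (simp add: height_def)

lemma lecture_hall_polytope_altdef:
  "lecture_hall_polytope s =
    {x :: real ^ 'n::{finite,linorder}. \<forall>k\<le>CARD('n). height s x k \<le> height s x (Suc k)}"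
proof -
  have *: "(\<forall>k\<le>CARD('n). Q k) \<longleftrightarrow> Q 0 \<and> (\<forall>k\<in>{1..<CARD('n)}. Q k) \<and> Q CARD('n)" for Q
    by (auto simp: Ball_def Suc_le_eq) (metis gr0I le_neq_implies_less)
  show ?thesis
    unfolding lecture_hall_polytope_def * by (auto simp: height_def Suc_le_eq)
qed

text \<open>Heights are affine functions of \<open>x\<close>. The same \<open>a\<close> and
  \<open>b\<close> serve the weak and the strict inequality, and \<open>a \<noteq> 0\<close> makes
  the open half-space the interior of the closed one.\<close>

lemma height_step_halfspace:
  fixes s :: "nat \<Rightarrow> nat"
  assumes "\<forall>k\<in>{1..CARD('n::{finite,linorder})}. 0 < s k" and "k \<le> CARD('n)"
  obtains a :: "real ^ 'n::{finite,linorder}" and b where "a \<noteq> 0"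
    "\<And>x. height s x k \<le> height s x (Suc k) \<longleftrightarrow> a \<bullet> x \<le> b"
    "\<And>x. height s x k < height s x (Suc k) \<longleftrightarrow> a \<bullet> x < b"
proof -
  \<comment> \<open>\<open>u j\<close> is the linear part and \<open>e j\<close> the constant part
    of the height at \<open>j\<close>; the linear part vanishes at both ends.\<close>
  define u :: "nat \<Rightarrow> real ^ 'n::{finite,linorder}" where
    "u j = (if j \<in> {1..CARD('n)} then axis (index j) (1 / real (s j)) else 0)" for j
  define e :: "nat \<Rightarrow> real" where "e j = of_bool (CARD('n) < j)" for j
  have h: "height s x j = u j \<bullet> x + e j" for x j
    by (auto simp: height_def u_def e_def coord_def inner_axis')
  have idx: "(index k :: 'n) \<noteq> index (Suc k)" if "k \<in> {1..CARD('n)}" "Suc k \<in> {1..CARD('n)}"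
    using that bij_betw_index[where 'n = 'n]
    by (metis bij_betw_imp_inj_on inj_onD n_not_Suc_n)
  have nz: "u j \<noteq> 0" if "j \<in> {1..CARD('n)}" for j
    using that assms(1) by (auto simp: u_def axis_eq_0_iff)
  have "u k - u (Suc k) \<noteq> 0"
  proof (cases "k \<in> {1..CARD('n)} \<and> Suc k \<in> {1..CARD('n)}")
    case True
    then have "u k \<noteq> u (Suc k)"
      using idx assms(1) by (auto simp: u_def axis_eq_axis)
    then show ?thesis by simp
  next
    case False
    \<comment> \<open>This excludes that \<open>k\<close> and \<open>Suc k\<close> are both outside
      the coordinate range, so exactly one of the two linear parts is zero.\<close>
    moreover have "1 \<le> CARD('n)" by (simp add: Suc_le_eq)
    ultimately have "k = 0 \<and> Suc k \<in> {1..CARD('n)} \<or> k \<in> {1..CARD('n)} \<and> Suc k \<notin> {1..CARD('n)}"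
      using assms(2) unfolding atLeastAtMost_iff by linarith
    then show ?thesis
      using nz[of k] nz[of "Suc k"] by (auto simp: u_def)
  qed
  then show thesis
    by (rule that[where b = "e (Suc k) - e k"]) (auto simp: h inner_diff_left)
qed

lemma convex_lecture_hall_polytope:
  assumes "\<forall>k\<in>{1..CARD('n::{finite,linorder})}. 0 < s k"
  shows "convex (lecture_hall_polytope s :: (real ^ 'n::{finite,linorder}) set)"
proof -
  have "convex {x :: real ^ 'n::{finite,linorder}. height s x k \<le> height s x (Suc k)}" if "k \<le> CARD('n)" for k
    by (rule height_step_halfspace[OF assms that]) (simp add: convex_halfspace_le)
  moreover have "lecture_hall_polytope s =
      (\<Inter>k\<in>{..CARD('n)}. {x :: real ^ 'n::{finite,linorder}. height s x k \<le> height s x (Suc k)})"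
    by (auto simp: lecture_hall_polytope_altdef)
  ultimately show ?thesis
    by (auto intro!: convex_INT)
qed

lemma interior_INT: "finite I \<Longrightarrow> interior (\<Inter>i\<in>I. A i) = (\<Inter>i\<in>I. interior (A i))"
  by (induction I rule: finite_induct) auto

text \<open>Interior commutes with finite intersections, so each closed half-space can be replaced
  by its open counterpart.\<close>

lemma interior_lecture_hall_polytope:
  assumes "\<forall>k\<in>{1..CARD('n::{finite,linorder})}. 0 < s k"
  shows "interior (lecture_hall_polytope s) =
    {x :: real ^ 'n::{finite,linorder}. \<forall>k\<le>CARD('n). height s x k < height s x (Suc k)}"
proof -
  have "interior {x :: real ^ 'n::{finite,linorder}. height s x k \<le> height s x (Suc k)} =
      {x. height s x k < height s x (Suc k)}" if "k \<le> CARD('n)" for k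
    by (rule height_step_halfspace[OF assms that]) simp
  moreover have "lecture_hall_polytope s =
      (\<Inter>k\<in>{..CARD('n)}. {x :: real ^ 'n::{finite,linorder}. height s x k \<le> height s x (Suc k)})"
    by (auto simp: lecture_hall_polytope_altdef)
  ultimately show ?thesis
    by (auto simp: interior_INT)
qed

section \<open>Vertices and the convex hull\<close>

definition lecture_hall_vertex :: "(nat \<Rightarrow> nat) \<Rightarrow> nat \<Rightarrow> real ^ 'n::{finite,linorder}" where
  "lecture_hall_vertex s j = vector_of (\<lambda>k. if j < k then real (s k) else 0)"

lemma coord_lecture_hall_vertex:
  assumes "k \<in> {1..CARD('n::{finite,linorder})}"
  shows "coord (lecture_hall_vertex s j :: real ^ 'n::{finite,linorder}) k = (if j < k then real (s k) else 0)"
  by (simp only: lecture_hall_vertex_def coord_vector_of[OF assms])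

lemma lecture_hall_polytope_eq_hull:
  assumes pos: "\<forall>k\<in>{1..CARD('n::{finite,linorder})}. 0 < s k"
  shows "lecture_hall_polytope s =
    convex hull (lecture_hall_vertex s ` {..CARD('n)} :: (real ^ 'n::{finite,linorder}) set)"
    (is "_ = convex hull ?V")
proof (rule antisym)
  \<comment> \<open>The heights of a vertex make a single jump from \<open>0\<close> to
    \<open>1\<close>, between \<open>j\<close> and \<open>Suc j\<close>, so they increase
    weakly.\<close>
  have "height s (lecture_hall_vertex s j :: real ^ 'n::{finite,linorder}) k = of_bool (j < k)"
    if "j \<le> CARD('n)" "k \<le> Suc CARD('n)" for j k
  proof (cases "k \<in> {1..CARD('n)}")
    case True
    then have "0 < s k" using pos by blast
    with True show ?thesis by (simp add: height_eq coord_lecture_hall_vertex)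
  next
    case False
    with that show ?thesis by (auto simp: height_def)
  qed
  then have "?V \<subseteq> lecture_hall_polytope s"
    by (auto simp: lecture_hall_polytope_altdef)
  then show "convex hull ?V \<subseteq> lecture_hall_polytope s"
    by (intro hull_minimal convex_lecture_hall_polytope[OF pos])
next
  show "lecture_hall_polytope s \<subseteq> convex hull ?V"
  proof
    fix x :: "real ^ 'n::{finite,linorder}"
    assume x: "x \<in> lecture_hall_polytope s"
    define t where "t j = height s x (Suc j) - height s x j" for j
    \<comment> \<open>For \<open>k\<close> in the coordinate range this recovers coordinate
      \<open>k\<close> up to the factor \<open>s k\<close>; at \<open>k = Suc CARD('n)\<close> it
      says that the weights sum to \<open>1\<close>.\<close>
    have tel: "(\<Sum>j<k. t j) = height s x k" for k
      unfolding t_def by (subst sum_lessThan_telescope) simp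
    let ?y = "\<Sum>j\<le>CARD('n). t j *\<^sub>R lecture_hall_vertex s j :: real ^ 'n::{finite,linorder}"
    have "?y = x"
    proof (rule vec_eq_coordI)
      fix k assume k: "k \<in> {1..CARD('n)}"
      have "coord ?y k =
          (\<Sum>j\<le>CARD('n). if j < k then t j * real (s k) else 0)"
        by (auto simp: coord_sum coord_scaleR coord_lecture_hall_vertex[OF k] intro: sum.cong)
      also have "\<dots> = (\<Sum>j<k. t j * real (s k))"
        using k by (intro sum.mono_neutral_cong_right) auto
      also have "\<dots> = coord x k"
        using pos k by (auto simp: sum_distrib_right[symmetric] tel height_eq)
      finally show "coord ?y k = coord x k" .
    qed
    moreover have "?y \<in> convex hull ?V"
    proof (rule convex_sum)
      show "(\<Sum>j\<le>CARD('n). t j) = 1"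
        using tel[of "Suc CARD('n)"] by (simp only: lessThan_Suc_atMost height_Suc_card)
      show "0 \<le> t j" if "j \<in> {..CARD('n)}" for j
        using that x by (auto simp: t_def lecture_hall_polytope_altdef)
    qed (auto intro: hull_inc)
    ultimately show "x \<in> convex hull ?V" by simp
  qed
qed

lemma lattice_polytope_lecture_hall:
  assumes "\<forall>k\<in>{1..CARD('n::{finite,linorder})}. 0 < s k"
  shows "lattice_polytope (lecture_hall_polytope s :: (real ^ 'n::{finite,linorder}) set)"
proof -
  have "(lecture_hall_vertex s ` {..CARD('n)} :: (real ^ 'n::{finite,linorder}) set) \<subseteq> integer_lattice"
    by (auto simp: integer_lattice_iff_coord coord_lecture_hall_vertex)
  then show ?thesis
    unfolding lattice_polytope_def lecture_hall_polytope_eq_hull[OF assms] by blast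
qed

section \<open>Interior lattice points\<close>

lemma interior_lattice_points_lecture_hall:
  assumes "\<forall>k\<in>{1..CARD('n::{finite,linorder})}. 0 < s k"
  shows "interior_lattice_points (lecture_hall_polytope s :: (real ^ 'n::{finite,linorder}) set) =
    {x. (\<forall>k\<le>CARD('n). height s x k < height s x (Suc k)) \<and> (\<forall>k\<in>{1..CARD('n)}. coord x k \<in> \<int>)}"
  by (auto simp: interior_lattice_points_altdef interior_lecture_hall_polytope[OF assms]
      integer_lattice_iff_coord)

lemma Ints_less_imp_add1_le:
  fixes a b :: "'a::linordered_idom"
  assumes "a \<in> \<int>" "b \<in> \<int>" "a < b"
  shows "a + 1 \<le> b"
proof -
  obtain m n where "a = of_int m" "b = of_int n"
    using assms by (elim Ints_cases)
  moreover from this assms(3) have "of_int (m + 1) \<le> (of_int n :: 'a)"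
    by (subst of_int_le_iff) auto
  ultimately show ?thesis by simp
qed

text \<open>Integer coordinates that increase strictly grow by at least \<open>1\<close> per step.
  The lower bound climbs from the first coordinate, the upper bound descends from the last
  one.\<close>

lemma coord_bounds_of_interior_lattice_point:
  fixes x :: "real ^ 'n::{finite,linorder}"
  assumes pos: "\<forall>k\<in>{1..CARD('n)}. 0 < s k"
    and incr: "\<forall>k\<in>{1..<CARD('n)}. s k \<le> s (Suc k)"
    and x: "x \<in> interior_lattice_points (lecture_hall_polytope s)"
    and k: "k \<in> {1..CARD('n)}"
  shows "real k \<le> coord x k" "coord x k + real CARD('n) + 1 \<le> real (s CARD('n)) + real k"
proof -
  have ht: "height s x j < height s x (Suc j)" if "j \<le> CARD('n)" for j
    using x that by (auto simp: interior_lattice_points_lecture_hall[OF pos])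
  have int: "coord x j \<in> \<int>" if "j \<in> {1..CARD('n)}" for j
    using x that by (auto simp: interior_lattice_points_lecture_hall[OF pos])
  have "0 < CARD('n)" by simp
  then have one: "1 \<in> {1..CARD('n)}" "CARD('n) \<in> {1..CARD('n)}" by auto
  have "0 < height s x 1"
    using ht[of 0] by simp
  then have "0 < coord x 1"
    by (simp only: height_eq[OF one(1)] zero_less_divide_iff) simp
  then have first: "1 \<le> coord x 1"
    using Ints_less_imp_add1_le[OF _ int[OF one(1)], of 0] by simp
  have last: "coord x CARD('n) + 1 \<le> real (s CARD('n))"
    using ht[of "CARD('n)"] pos one Ints_less_imp_add1_le[OF int[OF one(2)], of "real (s CARD('n))"]
    by (simp add: height_eq[OF one(2)])
  \<comment> \<open>Replacing \<open>s (Suc j)\<close> by the smaller \<open>s j\<close> after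
    cross-multiplication requires \<open>0 \<le> coord x j\<close>. The lower bounds supply this, so
    they are proved before the upper ones.\<close>
  have succ: "coord x j + 1 \<le> coord x (Suc j)" if j: "j \<in> {1..CARD('n)}" "Suc j \<in> {1..CARD('n)}"
    and nonneg: "0 \<le> coord x j" for j
  proof -
    have "coord x j * real (s (Suc j)) < coord x (Suc j) * real (s j)"
      using ht[of j] pos j by (simp add: height_eq field_simps)
    moreover have "coord x j * real (s j) \<le> coord x j * real (s (Suc j))"
      using incr j nonneg by (intro mult_left_mono) auto
    ultimately have "coord x j * real (s j) < coord x (Suc j) * real (s j)" by simp
    then have "coord x j < coord x (Suc j)"
      by (rule mult_right_less_imp_less) simp
    then show ?thesis
      using int j by (intro Ints_less_imp_add1_le)
  qed
  have lower: "real j \<le> coord x j" if "1 \<le> j" "j \<le> CARD('n)" for j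
    using that
  proof (induction j rule: nat_induct_at_least)
    case base
    show ?case using first by simp
  next
    case (Suc j)
    then show ?case using succ[of j] by simp
  qed
  show "real k \<le> coord x k" using lower k by simp
  have upper: "coord x j + real CARD('n) + 1 \<le> real (s CARD('n)) + real j"
    if "j \<le> CARD('n)" "1 \<le> j" for j
    using that
  proof (induction rule: inc_induct)
    case base
    show ?case using last by simp
  next
    case (step j)
    then show ?case using succ[of j] lower[of j] by simp
  qed
  show "coord x k + real CARD('n) + 1 \<le> real (s CARD('n)) + real k" using upper k by simp
qed

text \<open>Cross-multiplied, the height inequality at an inner \<open>k\<close> reads
  \<open>(k + c) * s (Suc k) < (Suc k + c) * s k\<close>. As
  \<open>s (Suc k) \<le> Suc (s k)\<close>, it follows from \<open>k + c < s k\<close>.\<close>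

lemma translated_staircase_interior_lattice_point:
  assumes step: "\<forall>k\<in>{1..<CARD('n::{finite,linorder})}. s k \<le> s (Suc k) \<and> s (Suc k) \<le> Suc (s k)"
    and c: "CARD('n::{finite,linorder}) + c < s CARD('n)"
  shows "(vector_of (\<lambda>k. real (k + c)) :: real ^ 'n::{finite,linorder})
    \<in> interior_lattice_points (lecture_hall_polytope s)"
proof -
  \<comment> \<open>Descending from \<open>k = CARD('n)\<close>, the left side drops by exactly
    \<open>1\<close> and \<open>s\<close> by at most \<open>1\<close>, so the strict inequality
    persists.\<close>
  have bound: "k + c < s k" if "k \<le> CARD('n)" "1 \<le> k" for k
    using that
  proof (induction rule: inc_induct)
    case base
    show ?case by (rule c)
  next
    case (step k)
    with assms(1) have "s (Suc k) \<le> Suc (s k)" by auto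
    with step show ?case by auto
  qed
  then have pos: "\<forall>k\<in>{1..CARD('n)}. 0 < s k" by fastforce
  define p :: "real ^ 'n::{finite,linorder}" where "p = vector_of (\<lambda>k. real (k + c))"
  have coord_p: "coord p k = real (k + c)" if "k \<in> {1..CARD('n)}" for k
    by (simp only: p_def coord_vector_of[OF that])
  have ht: "height s p k = real (k + c) / real (s k)" if "k \<in> {1..CARD('n)}" for k
    by (simp only: height_eq[OF that] coord_p[OF that])
  have "height s p k < height s p (Suc k)" if k: "k \<le> CARD('n)" for k
  proof -
    consider "k = 0" | "k = CARD('n)" "1 \<le> k" | "1 \<le> k" "k < CARD('n)"
      using k by linarith
    then show ?thesis
    proof cases
      case 1
      have "1 \<in> {1..CARD('n)}" by (simp add: Suc_le_eq)
      with 1 pos ht[of 1] show ?thesis by simp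
    next
      case 2
      then have "height s p k < 1"
        using ht[of k] c by simp
      with 2 show ?thesis by simp
    next
      case 3
      have "(k + c) * s (Suc k) \<le> (k + c) * Suc (s k)"
        using step 3 by (intro mult_le_mono2) auto
      also have "\<dots> < (Suc k + c) * s k"
        using bound[of k] 3 by simp
      finally have "real ((k + c) * s (Suc k)) < real ((Suc k + c) * s k)"
        by (simp only: of_nat_less_iff)
      moreover have "0 < s k" "0 < s (Suc k)" using pos 3 by auto
      ultimately show ?thesis
        using 3 by (simp add: ht field_simps)
    qed
  qed
  moreover have "coord p k \<in> \<int>" if "k \<in> {1..CARD('n)}" for k
    by (simp only: coord_p[OF that] Ints_of_nat)
  ultimately show ?thesis
    unfolding p_def[symmetric] interior_lattice_points_lecture_hall[OF pos] by blast
qed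

theorem theorem2p8:
  fixes s :: "nat \<Rightarrow> nat" and d :: nat
  assumes "CARD('n::{finite,linorder}) = d"
    and "\<forall>i\<in>{1..d}. 0 < s i"
    and "\<forall>i\<in>{1..<d}. s i \<le> s (i + 1) \<and>
           0 \<le> int (s (i + 1)) - int (s i) \<and> int (s (i + 1)) - int (s i) \<le> 1"
  shows "((\<exists>Q. fano_polytope Q \<and>
             translation_equivalent (lecture_hall_polytope s :: (real ^ 'n::{finite,linorder}) set) Q)
           \<longleftrightarrow> s d = d + 1) \<and>
         (s d = d + 1 \<longrightarrow>
           (\<exists>p. interior_lattice_points (lecture_hall_polytope s :: (real ^ 'n::{finite,linorder}) set) = {p} \<and>
                (\<forall>k\<in>{1..d}. coord p k = real k)))"
proof -
  let ?I = "interior_lattice_points (lecture_hall_polytope s :: (real ^ 'n::{finite,linorder}) set)"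
  let ?p = "\<lambda>c. vector_of (\<lambda>k. real (k + c)) :: real ^ 'n::{finite,linorder}"
  have d: "d \<in> {1..d}"
    using assms(1) zero_less_card_finite[where 'a = 'n] by auto
  have pos: "\<forall>k\<in>{1..CARD('n)}. 0 < s k"
    using assms by simp
  have step: "\<forall>k\<in>{1..<CARD('n)}. s k \<le> s (Suc k) \<and> s (Suc k) \<le> Suc (s k)"
    using assms by auto
  have p_mem: "?p c \<in> ?I" if "d + c < s d" for c
    using translated_staircase_interior_lattice_point[where 'n = 'n, OF step] that assms(1) by simp
  have coord_p: "coord (?p c) k = real (k + c)" if "k \<in> {1..d}" for c k
    using that assms(1) by (simp only: coord_vector_of)
  have bounds: "real k \<le> coord x k \<and> coord x k + real d + 1 \<le> real (s d) + real k"
    if "x \<in> ?I" "k \<in> {1..d}" for x k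
    using coord_bounds_of_interior_lattice_point[OF pos _ that(1), of k] step that(2) assms(1) by auto
  \<comment> \<open>For \<open>s d = d + 1\<close> the lower and the upper bound on coordinate
    \<open>k\<close> are both equal to \<open>k\<close>.\<close>
  have singleton: "?I = {?p 0}" if "s d = d + 1"
  proof -
    have "x = ?p 0" if "x \<in> ?I" for x
    proof (rule vec_eq_coordI)
      fix k assume "k \<in> {1..CARD('n)}"
      then have k: "k \<in> {1..d}" using assms(1) by simp
      show "coord x k = coord (?p 0) k"
        using bounds[OF that k] coord_p[OF k, of 0] \<open>s d = d + 1\<close> by simp
    qed
    moreover have "?p 0 \<in> ?I" using p_mem that by simp
    ultimately show ?thesis by blast
  qed
  have "s d = d + 1" if x: "?I = {x}" for x
  proof (rule ccontr)
    assume "s d \<noteq> d + 1"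
    moreover have "d + 1 \<le> s d"
      \<comment> \<open>At coordinate \<open>d\<close> the two bounds give
        \<open>d \<le> coord x d\<close> and \<open>coord x d + 1 \<le> s d\<close>. What remains is
        \<open>d + 2 \<le> s d\<close>, which admits the shifts \<open>c = 0\<close> and
        \<open>c = 1\<close>.\<close>
      using bounds[of x d] d x by auto
    ultimately have "?p 0 \<in> ?I" "?p 1 \<in> ?I"
      by (intro p_mem; simp)+
    then have "coord (?p 0) d = coord (?p 1) d" by (simp only: x singleton_iff)
    then show False unfolding coord_p[OF d] by simp
  qed
  with singleton have "(\<exists>p. ?I = {p}) \<longleftrightarrow> s d = d + 1" by blast
  then show ?thesis
    using translate_fano_iff[OF lattice_polytope_lecture_hall[OF pos]] singleton coord_p[of _ 0] by auto
qed

end
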